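(* Let $X$ be a zero-dimensional compact Hausdorff space. Then a function $f\in C_k(X,X)$ is a $P$-point of $C_k(X,X)$ if and only if $f$ assumes only finitely many values, all of which are $P$-points of $X$.
   Context: Zero-dimensional means having a base of clopen sets. $C_k(X,X)$ denotes the set of continuous functions $X\to X$ with the compact-open topology, generated by the subbasis of sets $[C,U]=\{f : f(C)\subseteq U\}$ with $C\subseteq X$ compact and $U\subseteq X$ open. A point $p$ of a space is a $P$-point if every countable intersection of neighbourhoods of $p$ contains a neighbourhood of $p$. *)

theory Defs
  imports "HOL-Analysis.Analysis"
begin

definition zero_dimensional_space :: "'a topology \<Rightarrow> bool" where
  "zero_dimensional_space X \<longleftrightarrow>
     (\<exists>\<B>. (\<forall>B. \<B> B \<longrightarrow> openin X B \<and> closedin X B) \<and> openin X = arbitrary union_of \<B>)"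

text \<open>As in the library's product topology, a function between carriers is represented by
  its extensional representative, so that functions agreeing on \<^term>\<open>topspace X\<close> are equal.\<close>

definition continuous_funs :: "'a topology \<Rightarrow> 'b topology \<Rightarrow> ('a \<Rightarrow> 'b) set" where
  "continuous_funs X Y = {f \<in> extensional (topspace X). continuous_map X Y f}"

definition compact_open_topology :: "'a topology \<Rightarrow> 'b topology \<Rightarrow> ('a \<Rightarrow> 'b) topology" where
  "compact_open_topology X Y =
     topology_generated_by
       {{f \<in> continuous_funs X Y. f ` C \<subseteq> U} | C U. compactin X C \<and> openin Y U}"

lemma topspace_compact_open_topology [simp]:
  "topspace (compact_open_topology X Y) = continuous_funs X Y"
proof -
  have "continuous_funs X Y \<in>
      {{f \<in> continuous_funs X Y. f ` C \<subseteq> U} | C U. compactin X C \<and> openin Y U}"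
    by (rule CollectI, rule exI[of _ "{}"], rule exI[of _ "{}"]) auto
  then show ?thesis
    unfolding compact_open_topology_def topology_generated_by_topspace by blast
qed

definition neighbourhood_in :: "'a topology \<Rightarrow> 'a \<Rightarrow> 'a set \<Rightarrow> bool" where
  "neighbourhood_in X p N \<longleftrightarrow> N \<subseteq> topspace X \<and> (\<exists>U. openin X U \<and> p \<in> U \<and> U \<subseteq> N)"

text \<open>The intersection of the empty family is omitted: within the space it is the whole
  of \<^term>\<open>topspace X\<close>, which is a neighbourhood of every point anyway.\<close>

definition P_point :: "'a topology \<Rightarrow> 'a \<Rightarrow> bool" where
  "P_point X p \<longleftrightarrow> p \<in> topspace X \<and>
     (\<forall>\<N>. countable \<N> \<and> \<N> \<noteq> {} \<and> (\<forall>N\<in>\<N>. neighbourhood_in X p N) \<longrightarrow>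
        (\<exists>M. neighbourhood_in X p M \<and> M \<subseteq> \<Inter>\<N>))"

end

theory Submission
  imports Defs
begin

text \<open>The argument is given for continuous functions from a compact space \<open>X\<close> to a
  zero-dimensional Hausdorff space \<open>Y\<close>, which keeps the roles of domain and codomain apart.

  The idea is that a neighbourhood of \<open>f\<close> can only test finitely much. If \<open>f\<close> maps a compact
  set into an open set \<open>U\<close>, then a clopen set fits between the image and \<open>U\<close>; hence every
  neighbourhood of \<open>f\<close> contains all continuous \<open>g\<close> that follow \<open>f\<close> through some finite family
  \<open>\<V>\<close> of clopen sets, in the sense that \<open>f x \<in> V\<close> implies \<open>g x \<in> V\<close> for \<open>V \<in> \<V>\<close>
  (lemma \<open>nhd_contains_followers\<close>). Two points of \<open>Y\<close> that lie in the same members of \<open>\<V>\<close>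
  cannot be told apart, and \<open>f\<close> may be made constant on a clopen set without leaving the space
  of continuous functions (lemma \<open>overwrite_constant\<close>).

  Suppose \<open>f\<close> is a \<open>P\<close>-point with infinitely many values, and let \<open>y\<^sub>0, y\<^sub>1, \<dots>\<close> be distinct
  ones. Choose a clopen set \<open>U\<^sub>m\<^sub>n\<close> around \<open>y\<^sub>m\<close> avoiding \<open>y\<^sub>n\<close>. The countably many conditions
  that \<open>g\<close> maps the preimage of \<open>U\<^sub>m\<^sub>n\<close> under \<open>f\<close> into \<open>U\<^sub>m\<^sub>n\<close> then follow from a finite
  family \<open>\<V>\<close>, and by the pigeonhole principle \<open>\<V>\<close> fails to separate some \<open>y\<^sub>m\<close> from some
  \<open>y\<^sub>n\<close>. Overwriting \<open>f\<close> by \<open>y\<^sub>n\<close> wherever its value is indistinguishable from \<open>y\<^sub>n\<close> violates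
  the condition for \<open>U\<^sub>m\<^sub>n\<close>.

  Once \<open>f\<close> has finitely many values its fibres are clopen. Overwriting \<open>f\<close> on the fibre over
  \<open>y\<close> by a point \<open>z\<close> near \<open>y\<close> gives a function near \<open>f\<close>, so that a common neighbourhood of
  \<open>f\<close> yields one of \<open>y\<close>, and \<open>y\<close> is a \<open>P\<close>-point; conversely, prescribing a neighbourhood of each of the finitely many values
  on the corresponding fibre is an open condition, which turns a common neighbourhood of each
  value into a common neighbourhood of \<open>f\<close>.\<close>

section \<open>Neighbourhoods in the compact-open topology\<close>

lemma compactin_clopen_between:
  assumes "zero_dimensional_space Y" "compactin Y K" "openin Y U" "K \<subseteq> U"
  obtains V where "openin Y V" "closedin Y V" "K \<subseteq> V" "V \<subseteq> U"
proof -
  obtain \<B> where B: "\<And>B. \<B> B \<Longrightarrow> openin Y B \<and> closedin Y B"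
    and eq: "openin Y = arbitrary union_of \<B>"
    using assms(1) unfolding zero_dimensional_space_def by blast
  obtain \<U> where U: "\<U> \<subseteq> Collect \<B>" "\<Union>\<U> = U"
    using assms(3) unfolding eq union_of_def arbitrary_def by auto
  have "\<And>B. B \<in> \<U> \<Longrightarrow> openin Y B" "K \<subseteq> \<Union>\<U>"
    using U B assms(4) by auto
  then obtain \<F> where F: "finite \<F>" "\<F> \<subseteq> \<U>" "K \<subseteq> \<Union>\<F>"
    using compactinD[OF assms(2)] by metis
  show thesis
  proof
    show "openin Y (\<Union>\<F>)" using F(2) U(1) B by blast
    show "closedin Y (\<Union>\<F>)" by (rule closedin_Union) (use F U(1) B in auto)
    show "K \<subseteq> \<Union>\<F>" "\<Union>\<F> \<subseteq> U" using F U by auto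
  qed
qed

lemma clopen_separating_points:
  assumes "zero_dimensional_space Y" "Hausdorff_space Y"
    and "y \<in> topspace Y" "z \<in> topspace Y" "y \<noteq> z"
  obtains V where "openin Y V" "closedin Y V" "y \<in> V" "z \<notin> V"
proof -
  have "openin Y (topspace Y - {z})"
    by (simp add: assms(2) closedin_Hausdorff_singleton assms(4) openin_diff)
  moreover have "compactin Y {y}" using assms(3) by simp
  ultimately obtain V where "openin Y V" "closedin Y V" "{y} \<subseteq> V" "V \<subseteq> topspace Y - {z}"
    using compactin_clopen_between[OF assms(1), of "{y}" "topspace Y - {z}"] assms(3,5) by blast
  then show thesis using that by blast
qed

lemma openin_compact_open_subbasic:
  assumes "compactin X C" "openin Y U"
  shows "openin (compact_open_topology X Y) {g \<in> continuous_funs X Y. g ` C \<subseteq> U}"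
  unfolding compact_open_topology_def
  by (rule topology_generated_by_Basis) (use assms in blast)

text \<open>The clopen sets replace both the compact and the open set of a subbasic
  neighbourhood: for \<open>f ` C \<subseteq> V \<subseteq> U\<close>, a function that stays in \<open>V\<close> wherever \<open>f\<close> does
  maps \<open>C\<close> into \<open>U\<close>. Finite intersections merge finite families.\<close>

lemma nhd_contains_followers:
  assumes Y: "zero_dimensional_space Y"
    and N: "neighbourhood_in (compact_open_topology X Y) f N"
  obtains \<V> where "finite \<V>" "\<forall>V\<in>\<V>. openin Y V \<and> closedin Y V"
    "{g \<in> continuous_funs X Y. \<forall>x\<in>topspace X. \<forall>V\<in>\<V>. f x \<in> V \<longrightarrow> g x \<in> V} \<subseteq> N"
proof -
  let ?S = "{{f \<in> continuous_funs X Y. f ` C \<subseteq> U} | C U. compactin X C \<and> openin Y U}"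
  let ?P = "\<lambda>W. \<exists>\<V>. finite \<V> \<and> (\<forall>V\<in>\<V>. openin Y V \<and> closedin Y V) \<and>
      {g \<in> continuous_funs X Y. \<forall>x\<in>topspace X. \<forall>V\<in>\<V>. f x \<in> V \<longrightarrow> g x \<in> V} \<subseteq> W"
  obtain W where W: "openin (compact_open_topology X Y) W" "f \<in> W" "W \<subseteq> N"
    using N unfolding neighbourhood_in_def by auto
  have "generate_topology_on ?S W"
    using W(1) by (simp add: compact_open_topology_def openin_topology_generated_by)
  then have "f \<in> W \<longrightarrow> ?P W"
  proof induction
    case Empty
    then show ?case by simp
  next
    case (Int a b)
    show ?case
    proof
      assume "f \<in> a \<inter> b"
      then have "?P a" "?P b" using Int.IH by blast+
      then obtain \<V> \<V>' where
        fin: "finite \<V>" "finite \<V>'"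
        and clopen: "\<forall>V\<in>\<V>. openin Y V \<and> closedin Y V" "\<forall>V\<in>\<V>'. openin Y V \<and> closedin Y V"
        and a: "{g \<in> continuous_funs X Y. \<forall>x\<in>topspace X. \<forall>V\<in>\<V>. f x \<in> V \<longrightarrow> g x \<in> V} \<subseteq> a"
        and b: "{g \<in> continuous_funs X Y. \<forall>x\<in>topspace X. \<forall>V\<in>\<V>'. f x \<in> V \<longrightarrow> g x \<in> V} \<subseteq> b"
        by (elim exE conjE)
      show "?P (a \<inter> b)"
      proof (intro exI[of _ "\<V> \<union> \<V>'"] conjI)
        show "finite (\<V> \<union> \<V>')" using fin by simp
        show "\<forall>V\<in>\<V> \<union> \<V>'. openin Y V \<and> closedin Y V" using clopen by blast
        show "{g \<in> continuous_funs X Y. \<forall>x\<in>topspace X. \<forall>V\<in>\<V> \<union> \<V>'. f x \<in> V \<longrightarrow> g x \<in> V}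
            \<subseteq> a \<inter> b"
          by (rule subset_trans[OF _ Int_mono[OF a b]]) auto
      qed
    qed
  next
    case (UN K)
    show ?case
    proof
      assume "f \<in> \<Union>K"
      then obtain k where k: "k \<in> K" "f \<in> k" by blast
      have "?P k" by (rule mp[OF UN.IH[OF k(1)] k(2)])
      then show "?P (\<Union>K)" using Union_upper[OF k(1)]
        by (elim exE conjE, intro exI conjI) (assumption | erule (1) subset_trans)+
    qed
  next
    case (Basis s)
    show ?case
    proof
      assume "f \<in> s"
      obtain C U where s: "s = {f \<in> continuous_funs X Y. f ` C \<subseteq> U}"
        and C: "compactin X C" and U: "openin Y U"
        using Basis.hyps by (elim CollectE exE conjE)
      have f: "continuous_map X Y f" "f ` C \<subseteq> U"
        using \<open>f \<in> s\<close> by (auto simp: s continuous_funs_def)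
      obtain V where V: "openin Y V" "closedin Y V" "f ` C \<subseteq> V" "V \<subseteq> U"
        using compactin_clopen_between[OF Y image_compactin[OF C f(1)] U f(2)] by blast
      have "C \<subseteq> topspace X" using C by (rule compactin_subset_topspace)
      then have "{g \<in> continuous_funs X Y. \<forall>x\<in>topspace X. \<forall>V\<in>{V}. f x \<in> V \<longrightarrow> g x \<in> V} \<subseteq> s"
        unfolding s using V by blast
      then show "?P s" using V by (intro exI[of _ "{V}"]) simp
    qed
  qed
  then have "?P W" using W(2) by (rule mp)
  then obtain \<V> where "finite \<V>" "\<forall>V\<in>\<V>. openin Y V \<and> closedin Y V"
    "{g \<in> continuous_funs X Y. \<forall>x\<in>topspace X. \<forall>V\<in>\<V>. f x \<in> V \<longrightarrow> g x \<in> V} \<subseteq> W"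
    by (elim exE conjE)
  then show thesis by (intro that) (assumption | erule subset_trans[OF _ W(3)])+
qed

lemma overwrite_constant:
  assumes f: "f \<in> continuous_funs X Y" and A: "openin X A" "closedin X A"
    and c: "c \<in> topspace Y"
  shows "(\<lambda>x. if x \<in> A then c else f x) \<in> continuous_funs X Y"
proof -
  let ?g = "\<lambda>x. if x \<in> A then c else f x"
  have AX: "A \<subseteq> topspace X" using A(1) by (rule openin_subset)
  have fc: "continuous_map X Y f" and fe: "f \<in> extensional (topspace X)"
    using f by (auto simp: continuous_funs_def)
  have "openin X {x \<in> topspace X. ?g x \<in> U}" if "openin Y U" for U
  proof -
    have "{x \<in> topspace X. ?g x \<in> U} =
        (if c \<in> U then A else {}) \<union> ({x \<in> topspace X. f x \<in> U} - A)"
      using AX by auto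
    moreover have "openin X {x \<in> topspace X. f x \<in> U}"
      using fc that by (rule openin_continuous_map_preimage)
    ultimately show ?thesis using A by (auto intro!: openin_Un openin_diff)
  qed
  moreover have "?g \<in> topspace X \<rightarrow> topspace Y"
    using fc c by (auto simp: continuous_map_def)
  ultimately have "continuous_map X Y ?g" by (simp add: continuous_map_def)
  moreover have "?g \<in> extensional (topspace X)"
    using fe AX by (auto simp: extensional_def)
  ultimately show ?thesis by (simp add: continuous_funs_def)
qed

lemma clopen_fibre_of_finite_range:
  assumes f: "continuous_map X Y f" and Y: "Hausdorff_space Y"
    and fin: "finite (f ` topspace X)"
  shows "openin X {x \<in> topspace X. f x = y}" "closedin X {x \<in> topspace X. f x = y}"
proof -
  have cl: "closedin X {x \<in> topspace X. f x \<in> T}" if "T \<subseteq> f ` topspace X" for T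
  proof -
    have "finite T" "T \<subseteq> topspace Y"
      using that fin finite_subset continuous_map_image_subset_topspace[OF f] by blast+
    then have "closedin Y T"
      using Y by (simp add: closedin_Hausdorff_finite)
    then show ?thesis by (rule closedin_continuous_map_preimage[OF f])
  qed
  have "{x \<in> topspace X. f x = y} = {x \<in> topspace X. f x \<in> {y} \<inter> f ` topspace X}"
    by auto
  then show "closedin X {x \<in> topspace X. f x = y}" using cl by (metis inf_le2)
  have "{x \<in> topspace X. f x = y} =
      topspace X - {x \<in> topspace X. f x \<in> f ` topspace X - {y}}"
    by auto
  then show "openin X {x \<in> topspace X. f x = y}"
    by (simp only:) (intro openin_diff openin_topspace cl Diff_subset)
qed

text \<open>A finite intersection of preimages of members of \<open>\<V>\<close> and of their complements. On this
  set \<open>f\<close> can be overwritten by \<open>y\<close> without \<open>\<V>\<close> noticing the change.\<close>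

lemma clopen_preimage_of_type:
  fixes f :: "'a \<Rightarrow> 'b" and y :: 'b
  assumes f: "continuous_map X Y f" and fin: "finite \<V>"
    and V: "\<And>V. V \<in> \<V> \<Longrightarrow> openin Y V \<and> closedin Y V"
  defines "A \<equiv> {x \<in> topspace X. \<forall>V\<in>\<V>. f x \<in> V \<longleftrightarrow> y \<in> V}"
  shows "openin X A" "closedin X A"
proof -
  let ?T = "\<lambda>V. {x \<in> topspace X. f x \<in> V \<longleftrightarrow> y \<in> V}"
  have T: "openin X (?T V) \<and> closedin X (?T V)" if "V \<in> \<V>" for V
  proof -
    have "openin X {x \<in> topspace X. f x \<in> V}" "closedin X {x \<in> topspace X. f x \<in> V}"
      using V[OF that] f openin_continuous_map_preimage closedin_continuous_map_preimage
      by blast+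
    moreover have "?T V = (if y \<in> V then {x \<in> topspace X. f x \<in> V}
        else topspace X - {x \<in> topspace X. f x \<in> V})"
      by auto
    ultimately show ?thesis by auto
  qed
  have A: "A = \<Inter> (insert (topspace X) (?T ` \<V>))"
    unfolding A_def by auto
  show "openin X A" unfolding A by (rule openin_Inter) (use fin T in auto)
  show "closedin X A" unfolding A by (rule closedin_Inter) (use T in auto)
qed

section \<open>P-points of the function space\<close>

lemma openin_neighbourhood_in:
  assumes "openin X U" "p \<in> U" shows "neighbourhood_in X p U"
  using assms openin_subset unfolding neighbourhood_in_def by blast

lemma neighbourhood_inE:
  assumes "neighbourhood_in X p N"
  obtains U where "openin X U" "p \<in> U" "U \<subseteq> N"
  using assms unfolding neighbourhood_in_def by (elim conjE exE)

lemma P_point_common_neighbourhood: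
  assumes "P_point X p" "countable I" "I \<noteq> {}"
    and "\<And>i. i \<in> I \<Longrightarrow> neighbourhood_in X p (N i)"
  obtains M where "neighbourhood_in X p M" "\<And>i. i \<in> I \<Longrightarrow> M \<subseteq> N i"
proof -
  have "countable (N ` I) \<and> N ` I \<noteq> {} \<and> (\<forall>K\<in>N ` I. neighbourhood_in X p K)"
    using assms(2-4) by simp
  then obtain M where "neighbourhood_in X p M" "M \<subseteq> \<Inter>(N ` I)"
    using assms(1) unfolding P_point_def by (elim conjE allE[of _ "N ` I"] impE exE) simp_all
  then show thesis using that by (meson INT_lower subset_trans)
qed

text \<open>A neighbourhood of \<open>f\<close> separates only finitely many classes of points of \<open>Y\<close>, whereas
  countably many neighbourhoods together can separate all terms of a sequence of values.\<close>

lemma finite_range_of_P_point: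
  assumes X: "compact_space X" and Y: "zero_dimensional_space Y" "Hausdorff_space Y"
    and P: "P_point (compact_open_topology X Y) f"
  shows "finite (f ` topspace X)"
proof (rule ccontr)
  assume "infinite (f ` topspace X)"
  then obtain y :: "nat \<Rightarrow> 'b" where y: "inj y" "range y \<subseteq> f ` topspace X"
    using infinite_countable_subset by blast
  have f: "f \<in> continuous_funs X Y" and fc: "continuous_map X Y f"
    using P by (auto simp: P_point_def continuous_funs_def)
  have yY: "y n \<in> topspace Y" for n
    using y(2) continuous_map_image_subset_topspace[OF fc] by blast
  have "\<exists>V. openin Y V \<and> closedin Y V \<and> y m \<in> V \<and> (m \<noteq> n \<longrightarrow> y n \<notin> V)" for m n
  proof (cases "m = n")
    case True
    \<comment> \<open>A harmless choice on the diagonal, so that the family is indexed by all pairs.\<close>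
    then show ?thesis using yY by (intro exI[of _ "topspace Y"]) auto
  next
    case False
    then have "y m \<noteq> y n" using y(1) by (simp add: inj_eq)
    then show ?thesis using clopen_separating_points[OF Y yY[of m] yY[of n]] by blast
  qed
  then obtain U where U: "\<And>m n. openin Y (U m n)" "\<And>m n. closedin Y (U m n)"
    "\<And>m n. y m \<in> U m n" "\<And>m n. m \<noteq> n \<Longrightarrow> y n \<notin> U m n"
    by metis
  define pre where "pre m n = {x \<in> topspace X. f x \<in> U m n}" for m n
  define N where "N = (\<lambda>(m, n). {g \<in> continuous_funs X Y. g ` pre m n \<subseteq> U m n})"
  have "neighbourhood_in (compact_open_topology X Y) f (N p)" for p
  proof -
    obtain m n where p: "p = (m, n)" by (cases p)
    have "compactin X (pre m n)" unfolding pre_def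
      by (rule closedin_compact_space[OF X closedin_continuous_map_preimage[OF fc U(2)]])
    then have "openin (compact_open_topology X Y) (N p)"
      unfolding N_def p prod.case by (rule openin_compact_open_subbasic[OF _ U(1)])
    moreover have "f \<in> N p" using f by (auto simp: N_def p pre_def)
    ultimately show ?thesis by (rule openin_neighbourhood_in)
  qed
  then obtain M where M: "neighbourhood_in (compact_open_topology X Y) f M" "\<And>p. M \<subseteq> N p"
    using P_point_common_neighbourhood[OF P, of UNIV N] by auto
  obtain \<V> where fin: "finite \<V>" and clopen: "\<forall>V\<in>\<V>. openin Y V \<and> closedin Y V"
    and VM: "{g \<in> continuous_funs X Y. \<forall>x\<in>topspace X. \<forall>V\<in>\<V>. f x \<in> V \<longrightarrow> g x \<in> V} \<subseteq> M"
    by (rule nhd_contains_followers[OF Y(1) M(1)])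
  have V: "openin Y V \<and> closedin Y V" if "V \<in> \<V>" for V
    using clopen that by blast
  \<comment> \<open>There are at most \<open>2 ^ card \<V>\<close> traces on \<open>\<V>\<close>, so two of the values share one.\<close>
  define trace where "trace n = {V \<in> \<V>. y n \<in> V}" for n
  have "finite (range trace)"
    by (rule finite_subset[of _ "Pow \<V>"]) (use fin in \<open>auto simp: trace_def\<close>)
  then have "\<not> inj trace" using range_inj_infinite by blast
  then obtain m n where mn: "m \<noteq> n" "trace m = trace n" by (auto simp: inj_def)
  define A where "A = {x \<in> topspace X. \<forall>V\<in>\<V>. f x \<in> V \<longleftrightarrow> y n \<in> V}"
  define g where "g = (\<lambda>x. if x \<in> A then y n else f x)"
  have "openin X A" "closedin X A"
    unfolding A_def using clopen_preimage_of_type[OF fc fin V] by auto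
  then have "g \<in> continuous_funs X Y"
    unfolding g_def using overwrite_constant[OF f _ _ yY] by blast
  moreover have "\<forall>x\<in>topspace X. \<forall>V\<in>\<V>. f x \<in> V \<longrightarrow> g x \<in> V"
    by (auto simp: g_def A_def)
  ultimately have "g \<in> M" by (intro subsetD[OF VM] CollectI conjI)
  then have "g \<in> N (m, n)" by (rule subsetD[OF M(2)])
  then have gU: "g ` pre m n \<subseteq> U m n" by (simp add: N_def)
  have "y m \<in> f ` topspace X" by (rule subsetD[OF y(2) rangeI])
  then obtain x where x: "x \<in> topspace X" "f x = y m" by (rule imageE) simp
  have "x \<in> A" using x mn(2) by (auto simp: A_def trace_def)
  moreover have "x \<in> pre m n" using x U(3) by (simp add: pre_def)
  ultimately show False using gU U(4)[OF mn(1)] by (auto simp: g_def)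
qed

text \<open>For neighbourhoods \<open>N\<close> of \<open>y\<close>, the functions mapping the fibre \<open>A\<close> over \<open>y\<close> into \<open>N\<close>
  form a neighbourhood of \<open>f\<close>. A common neighbourhood of \<open>f\<close> is brought back to \<open>Y\<close> by
  testing it on the functions that take a constant value \<open>z\<close> on \<open>A\<close> and agree with \<open>f\<close>
  elsewhere.\<close>

lemma P_point_value_of_P_point:
  assumes X: "compact_space X" and Y: "zero_dimensional_space Y" "Hausdorff_space Y"
    and P: "P_point (compact_open_topology X Y) f"
    and y: "y \<in> f ` topspace X"
  shows "P_point Y y"
  unfolding P_point_def
proof (intro conjI allI impI)
  have f: "f \<in> continuous_funs X Y" and fc: "continuous_map X Y f"
    using P by (auto simp: P_point_def continuous_funs_def)
  show "y \<in> topspace Y"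
    using y continuous_map_image_subset_topspace[OF fc] by blast
  fix \<N> assume N: "countable \<N> \<and> \<N> \<noteq> {} \<and> (\<forall>N\<in>\<N>. neighbourhood_in Y y N)"
  define A where "A = {x \<in> topspace X. f x = y}"
  have A: "openin X A" "closedin X A"
    unfolding A_def
    using clopen_fibre_of_finite_range[OF fc Y(2) finite_range_of_P_point[OF X Y P]] by auto
  obtain a where a: "a \<in> A" using y by (auto simp: A_def)
  define F where "F N = {g \<in> continuous_funs X Y. g ` A \<subseteq> N}" for N
  have "neighbourhood_in (compact_open_topology X Y) f (F N)" if "N \<in> \<N>" for N
  proof -
    have "neighbourhood_in Y y N" using N that by blast
    then obtain U where U: "openin Y U" "y \<in> U" "U \<subseteq> N" by (rule neighbourhood_inE)
    have "openin (compact_open_topology X Y) (F U)" unfolding F_def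
      by (rule openin_compact_open_subbasic[OF closedin_compact_space[OF X A(2)] U(1)])
    moreover have "f \<in> F U" "F U \<subseteq> F N" using f U by (auto simp: F_def A_def)
    moreover have "F N \<subseteq> topspace (compact_open_topology X Y)" by (auto simp: F_def)
    ultimately show ?thesis
      unfolding neighbourhood_in_def by (intro conjI exI[of _ "F U"])
  qed
  then obtain M where M: "neighbourhood_in (compact_open_topology X Y) f M"
      "\<And>N. N \<in> \<N> \<Longrightarrow> M \<subseteq> F N"
    using P_point_common_neighbourhood[OF P, of \<N> F] N by auto
  obtain \<V> where fin: "finite \<V>" and clopen: "\<forall>V\<in>\<V>. openin Y V \<and> closedin Y V"
    and VM: "{g \<in> continuous_funs X Y. \<forall>x\<in>topspace X. \<forall>V\<in>\<V>. f x \<in> V \<longrightarrow> g x \<in> V} \<subseteq> M"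
    by (rule nhd_contains_followers[OF Y(1) M(1)])
  have V: "openin Y V \<and> closedin Y V" if "V \<in> \<V>" for V
    using clopen that by blast
  define W where "W = \<Inter> (insert (topspace Y) {V \<in> \<V>. y \<in> V})"
  have "openin Y W" unfolding W_def by (rule openin_Inter) (use fin V in auto)
  moreover have "y \<in> W" using \<open>y \<in> topspace Y\<close> by (auto simp: W_def)
  ultimately have "neighbourhood_in Y y W" by (rule openin_neighbourhood_in)
  moreover have "W \<subseteq> \<Inter>\<N>"
  proof
    fix z assume z: "z \<in> W"
    define g where "g = (\<lambda>x. if x \<in> A then z else f x)"
    have "z \<in> topspace Y" using z by (auto simp: W_def)
    then have "g \<in> continuous_funs X Y"
      unfolding g_def by (rule overwrite_constant[OF f A])
    moreover have "\<forall>x\<in>topspace X. \<forall>V\<in>\<V>. f x \<in> V \<longrightarrow> g x \<in> V"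
      using z by (auto simp: g_def A_def W_def)
    ultimately have "g \<in> M" by (intro subsetD[OF VM] CollectI conjI)
    moreover have "g a = z" using a by (simp add: g_def)
    ultimately show "z \<in> \<Inter>\<N>" using M(2) a by (fastforce simp: F_def)
  qed
  ultimately show "\<exists>M. neighbourhood_in Y y M \<and> M \<subseteq> \<Inter>\<N>" by blast
qed

text \<open>Each of the countably many neighbourhoods of \<open>f\<close> is controlled by a finite family of open
  sets, so at every value \<open>y\<close> of \<open>f\<close> only countably many open sets are involved, and these
  have a common neighbourhood \<open>W y\<close>. Finiteness of the range makes the condition
  \<open>g x \<in> W (f x)\<close> for all \<open>x\<close> an open one.\<close>

lemma P_point_of_finite_range:
  assumes X: "compact_space X" and Y: "zero_dimensional_space Y" "Hausdorff_space Y"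
    and f: "f \<in> continuous_funs X Y"
    and fin: "finite (f ` topspace X)"
    and P: "\<And>y. y \<in> f ` topspace X \<Longrightarrow> P_point Y y"
  shows "P_point (compact_open_topology X Y) f"
  unfolding P_point_def
proof (intro conjI allI impI)
  show "f \<in> topspace (compact_open_topology X Y)" using f by simp
  have fc: "continuous_map X Y f" using f by (simp add: continuous_funs_def)
  fix \<N>
  assume N: "countable \<N> \<and> \<N> \<noteq> {} \<and>
    (\<forall>N\<in>\<N>. neighbourhood_in (compact_open_topology X Y) f N)"
  have "\<forall>N\<in>\<N>. \<exists>\<V>. finite \<V> \<and> (\<forall>V\<in>\<V>. openin Y V \<and> closedin Y V) \<and>
      {g \<in> continuous_funs X Y. \<forall>x\<in>topspace X. \<forall>V\<in>\<V>. f x \<in> V \<longrightarrow> g x \<in> V} \<subseteq> N"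
  proof
    fix N assume "N \<in> \<N>"
    then have "neighbourhood_in (compact_open_topology X Y) f N" using N by blast
    then show "\<exists>\<V>. finite \<V> \<and> (\<forall>V\<in>\<V>. openin Y V \<and> closedin Y V) \<and>
      {g \<in> continuous_funs X Y. \<forall>x\<in>topspace X. \<forall>V\<in>\<V>. f x \<in> V \<longrightarrow> g x \<in> V} \<subseteq> N"
      by (rule nhd_contains_followers[OF Y(1)]) (intro exI conjI)
  qed
  from bchoice[OF this] obtain \<V> where \<V>: "\<forall>N\<in>\<N>. finite (\<V> N) \<and>
      (\<forall>V\<in>\<V> N. openin Y V \<and> closedin Y V) \<and>
      {g \<in> continuous_funs X Y. \<forall>x\<in>topspace X. \<forall>V\<in>\<V> N. f x \<in> V \<longrightarrow> g x \<in> V} \<subseteq> N"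
    by (elim exE)
  have V: "finite (\<V> N)" "\<And>V. V \<in> \<V> N \<Longrightarrow> openin Y V" if "N \<in> \<N>" for N
    using bspec[OF \<V> that] by simp_all
  have "\<forall>y\<in>f ` topspace X. \<exists>W. openin Y W \<and> y \<in> W \<and>
      (\<forall>N\<in>\<N>. \<forall>V\<in>\<V> N. y \<in> V \<longrightarrow> W \<subseteq> V)"
  proof
    fix y assume y: "y \<in> f ` topspace X"
    define T where "T = insert (topspace Y) {V \<in> (\<Union>N\<in>\<N>. \<V> N). y \<in> V}"
    have "y \<in> topspace Y" using P[OF y] by (simp add: P_point_def)
    then have "neighbourhood_in Y y V" if "V \<in> T" for V
      using that V(2) by (intro openin_neighbourhood_in) (auto simp: T_def)
    moreover have "countable (\<Union>N\<in>\<N>. \<V> N)"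
      using N V(1) by (intro countable_UN) (auto simp: countable_finite)
    then have "countable T" unfolding T_def
      by (intro countable_insert) (rule countable_subset[rotated], auto)
    moreover have "T \<noteq> {}" by (simp add: T_def)
    ultimately obtain M where M: "neighbourhood_in Y y M" "\<And>V. V \<in> T \<Longrightarrow> M \<subseteq> V"
      using P_point_common_neighbourhood[OF P[OF y], of T "\<lambda>V. V"] by blast
    from M(1) obtain W where W: "openin Y W" "y \<in> W" "W \<subseteq> M" by (rule neighbourhood_inE)
    have "W \<subseteq> V" if "N \<in> \<N>" "V \<in> \<V> N" "y \<in> V" for N V
      by (rule subset_trans[OF W(3) M(2)]) (use that in \<open>auto simp: T_def\<close>)
    then show "\<exists>W. openin Y W \<and> y \<in> W \<and> (\<forall>N\<in>\<N>. \<forall>V\<in>\<V> N. y \<in> V \<longrightarrow> W \<subseteq> V)"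
      using W(1,2) by (intro exI[of _ W]) simp
  qed
  from bchoice[OF this] obtain W where W: "\<forall>y\<in>f ` topspace X. openin Y (W y) \<and> y \<in> W y \<and>
      (\<forall>N\<in>\<N>. \<forall>V\<in>\<V> N. y \<in> V \<longrightarrow> W y \<subseteq> V)"
    by (elim exE)
  let ?E = "\<lambda>y. {g \<in> continuous_funs X Y. g ` {x \<in> topspace X. f x = y} \<subseteq> W y}"
  \<comment> \<open>The whole space is added because the range of \<open>f\<close> is empty when \<open>X\<close> is.\<close>
  define M where "M = \<Inter> (insert (continuous_funs X Y) (?E ` f ` topspace X))"
  have "openin (compact_open_topology X Y) (?E y)" if "y \<in> f ` topspace X" for y
    using clopen_fibre_of_finite_range(2)[OF fc Y(2) fin] conjunct1[OF bspec[OF W that]]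
    by (intro openin_compact_open_subbasic closedin_compact_space[OF X])
  moreover have "openin (compact_open_topology X Y) (continuous_funs X Y)"
    by (metis openin_topspace topspace_compact_open_topology)
  ultimately have "openin (compact_open_topology X Y) M"
    unfolding M_def by (intro openin_Inter) (use fin in auto)
  moreover have "f \<in> M" using f W by (auto simp: M_def)
  ultimately have "neighbourhood_in (compact_open_topology X Y) f M"
    by (rule openin_neighbourhood_in)
  moreover have "M \<subseteq> \<Inter>\<N>"
  proof (intro subsetI InterI)
    fix g N assume g: "g \<in> M" and "N \<in> \<N>"
    have gW: "g x \<in> W (f x)" if "x \<in> topspace X" for x
      using g that by (auto simp: M_def)
    have "g \<in> continuous_funs X Y" using g by (simp add: M_def)
    moreover have "\<forall>x\<in>topspace X. \<forall>V\<in>\<V> N. f x \<in> V \<longrightarrow> g x \<in> V"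
      using gW W \<open>N \<in> \<N>\<close> by (meson imageI subsetD)
    ultimately show "g \<in> N" using bspec[OF \<V> \<open>N \<in> \<N>\<close>]
      by (elim conjE) (erule subsetD, intro CollectI conjI)
  qed
  ultimately show "\<exists>M. neighbourhood_in (compact_open_topology X Y) f M \<and> M \<subseteq> \<Inter>\<N>"
    by blast
qed

theorem theorem6p8:
  fixes X :: "'a topology" and f :: "'a \<Rightarrow> 'a"
  assumes "zero_dimensional_space X"
    and "compact_space X"
    and "Hausdorff_space X"
    and "f \<in> topspace (compact_open_topology X X)"
  shows "P_point (compact_open_topology X X) f \<longleftrightarrow>
    finite (f ` topspace X) \<and> (\<forall>y \<in> f ` topspace X. P_point X y)"
proof
  assume P: "P_point (compact_open_topology X X) f"
  then show "finite (f ` topspace X) \<and> (\<forall>y \<in> f ` topspace X. P_point X y)"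
    using finite_range_of_P_point[OF assms(2,1,3) P]
      P_point_value_of_P_point[OF assms(2,1,3) P] by (intro conjI ballI)
next
  assume "finite (f ` topspace X) \<and> (\<forall>y \<in> f ` topspace X. P_point X y)"
  moreover have "f \<in> continuous_funs X X" using assms(4) by simp
  ultimately show "P_point (compact_open_topology X X) f"
    by (intro P_point_of_finite_range[OF assms(2,1,3)]) (elim conjE, erule (1) bspec | simp)+
qed

end
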